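(* Let $\mathbb{X}$ be a Banach space and let $\mathbb{Y}$ be a finite-dimensional subspace of $\mathbb{X}$. If $\mathbb{Y}$ is strongly anti-coproximinal in $\mathbb{X}$, then $\mathbb{Y}$ intersects every maximal face of $B_{\mathbb{X}}$.
   Context: Banach spaces are over $\mathbb{K}=\mathbb{R}$ or $\mathbb{C}$; $B_{\mathbb{X}}$ and $S_{\mathbb{X}}$ denote the closed unit ball and unit sphere of $\mathbb{X}$. A convex set $F\subset S_{\mathbb{X}}$ is a face of $B_{\mathbb{X}}$ if for any $y,z\in B_{\mathbb{X}}$, $\frac12(y+z)\in F$ implies $y,z\in F$. A face $F$ is a maximal face if for any face $F'$ of $B_{\mathbb{X}}$, $F\subset F'$ implies $F=F'$. For $\epsilon\in[0,1)$ and $x,y\in\mathbb{X}$, write $x\perp_B^{\epsilon} y$ if $\|x+\lambda y\|\ge \|x\|-\epsilon\|\lambda y\|$ for every $\lambda\in\mathbb{K}$. For a subspace $\mathbb{Y}$ of $\mathbb{X}$ and $x\in\mathbb{X}$, an element $y_0\in\mathbb{Y}$ is an $\epsilon$-best coapproximation to $x$ out of $\mathbb{Y}$ if $y\perp_B^{\epsilon}(x-y_0)$ for all $y\in\mathbb{Y}$. The subspace $\mathbb{Y}$ is strongly anti-coproximinal in $\mathbb{X}$ if for every $x\in\mathbb{X}\setminus\mathbb{Y}$ and every $\epsilon\in[0,1)$ there is no $\epsilon$-best coapproximation to $x$ out of $\mathbb{Y}$. *)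

theory Defs
  imports "HOL-Analysis.Analysis"
begin

text \<open>
  A normed space over \<open>K\<close> is a real normed space together with a \<open>K\<close>-scaling that extends
  the real scaling and for which the norm is absolutely homogeneous; it is used below only for
  \<open>K\<close> the type \<^typ>\<open>real\<close> or \<^typ>\<open>complex\<close>. Completeness is imposed by the sort \<^class>\<open>banach\<close>.
\<close>

locale normed_space_over = vector_space smul
  for smul :: "'k::real_normed_field \<Rightarrow> 'a::real_normed_vector \<Rightarrow> 'a" +
  assumes scale_of_real: "smul (of_real r) x = r *\<^sub>R x"
    and norm_scale: "norm (smul c x) = norm c * norm x"

lemma normed_space_over_scaleR:
  "normed_space_over (scaleR :: real \<Rightarrow> 'a::real_normed_vector \<Rightarrow> 'a)"
  by unfold_locales (simp_all add: algebra_simps)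

definition finite_dim_subspace ::
    "('k::real_normed_field \<Rightarrow> 'a::real_normed_vector \<Rightarrow> 'a) \<Rightarrow> 'a set \<Rightarrow> bool" where
  "finite_dim_subspace smul Y \<longleftrightarrow>
     module.subspace smul Y \<and> (\<exists>B. finite B \<and> module.span smul B = Y)"

lemma finite_dim_subspace_scaleR:
  "finite_dim_subspace scaleR Y \<longleftrightarrow> subspace Y \<and> (\<exists>B. finite B \<and> span B = Y)"
  by (simp add: finite_dim_subspace_def subspace_raw_def span_raw_def)

text \<open>
  The empty set is not counted as a face. This matters only in the zero space, whose unit sphere
  is empty: in a nonzero space the empty set is never maximal among faces.
\<close>

definition unit_ball_face :: "'a::real_normed_vector set \<Rightarrow> bool" where
  "unit_ball_face F \<longleftrightarrow>
     F \<noteq> {} \<and> convex F \<and> F \<subseteq> sphere 0 1 \<and>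
     (\<forall>y \<in> cball 0 1. \<forall>z \<in> cball 0 1. (1 / 2) *\<^sub>R (y + z) \<in> F \<longrightarrow> y \<in> F \<and> z \<in> F)"

definition maximal_unit_ball_face :: "'a::real_normed_vector set \<Rightarrow> bool" where
  "maximal_unit_ball_face F \<longleftrightarrow>
     unit_ball_face F \<and> (\<forall>F'. unit_ball_face F' \<and> F \<subseteq> F' \<longrightarrow> F = F')"

definition eps_birkhoff_orthogonal ::
    "('k::real_normed_field \<Rightarrow> 'a::real_normed_vector \<Rightarrow> 'a) \<Rightarrow> real \<Rightarrow> 'a \<Rightarrow> 'a \<Rightarrow> bool" where
  "eps_birkhoff_orthogonal smul \<epsilon> x y \<longleftrightarrow>
     (\<forall>c. norm (x + smul c y) \<ge> norm x - \<epsilon> * norm (smul c y))"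

definition eps_best_coapproximation ::
    "('k::real_normed_field \<Rightarrow> 'a::real_normed_vector \<Rightarrow> 'a) \<Rightarrow> real \<Rightarrow> 'a set \<Rightarrow> 'a \<Rightarrow> 'a \<Rightarrow> bool" where
  "eps_best_coapproximation smul \<epsilon> Y x y\<^sub>0 \<longleftrightarrow>
     y\<^sub>0 \<in> Y \<and> (\<forall>y \<in> Y. eps_birkhoff_orthogonal smul \<epsilon> y (x - y\<^sub>0))"

definition strongly_anti_coproximinal ::
    "('k::real_normed_field \<Rightarrow> 'a::real_normed_vector \<Rightarrow> 'a) \<Rightarrow> 'a set \<Rightarrow> bool" where
  "strongly_anti_coproximinal smul Y \<longleftrightarrow>
     (\<forall>x. x \<notin> Y \<longrightarrow> (\<forall>\<epsilon> \<in> {0..<1}. \<not> (\<exists>y\<^sub>0. eps_best_coapproximation smul \<epsilon> Y x y\<^sub>0)))"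

end

theory Submission
  imports Defs
begin

text \<open>
  The contrapositive is proved. Let \<open>F\<close> be a maximal face that misses the finite-dimensional
  subspace \<open>Y\<close>, and let \<open>S\<close> be the unit sphere of \<open>Y\<close>, which is compact
  (\<open>compact_span_Int_cball\<close>). Some \<open>x \<in> F\<close> satisfies \<open>\<parallel>x + y\<parallel> < 2\<close> for every \<open>y \<in> S\<close>.
  Indeed, if \<open>y\<close> is a unit vector with \<open>\<parallel>x + y\<parallel> = 2\<close> for all \<open>x \<in> F\<close>, then the convex hull of
  \<open>F\<close> and \<open>y\<close> lies in the unit sphere, so it generates a face, and by maximality \<open>y \<in> F\<close>
  (\<open>mem_maximal_unit_ball_face\<close>). Hence each \<open>y \<in> S\<close> has its own \<open>x \<in> F\<close> with \<open>\<parallel>x + y\<parallel> < 2\<close>;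
  compactness reduces these to finitely many, and a point of \<open>F\<close> that averages them works for
  all \<open>y\<close> at once, because \<open>\<parallel>(x + x')/2 + y\<parallel> = 2\<close> forces \<open>\<parallel>x + y\<parallel> = \<parallel>x' + y\<parallel> = 2\<close>.

  By compactness again, \<open>\<parallel>x + y\<parallel> \<le> 1 + \<epsilon>\<close> on \<open>S\<close> for some \<open>\<epsilon> < 1\<close>. The triangle inequality
  applied to \<open>(s + 1) w = (s w - x) + (x + w)\<close> with \<open>w \<in> S\<close> and \<open>s > 0\<close> gives
  \<open>\<parallel>s w - x\<parallel> \<ge> s - \<epsilon>\<close>, which after rescaling says that every element of \<open>Y\<close> is
  \<open>\<epsilon>\<close>-orthogonal to \<open>x\<close>. So \<open>0\<close> is an \<open>\<epsilon>\<close>-best coapproximation to \<open>x\<close>, although \<open>x \<notin> Y\<close>.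

  The argument is uniform in the scalar field: only the compactness of its bounded closed sets
  is used.
\<close>

section \<open>Faces of the unit ball\<close>

text \<open>
  The smallest face containing \<open>C\<close> consists of the points \<open>y\<close> of the ball for which some
  \<open>c \<in> C\<close> is a convex combination \<open>t y + (1 - t) z\<close> with \<open>t > 0\<close> and \<open>z\<close> in the ball; the
  existence of \<open>z\<close> is expressed as \<open>\<parallel>c - t y\<parallel> \<le> 1 - t\<close>.
\<close>

lemma convex_subset_sphere_in_face:
  fixes C :: "'a::real_normed_vector set"
  assumes "convex C" "C \<noteq> {}" "C \<subseteq> sphere 0 1"
  obtains F where "unit_ball_face F" "C \<subseteq> F"
proof -
  define F where
    "F = {y. norm y \<le> 1 \<and> (\<exists>c\<in>C. \<exists>t. 0 < t \<and> t \<le> 1 \<and> norm (c - t *\<^sub>R y) \<le> 1 - t)}"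
  have shrink: "norm (c - s *\<^sub>R y) \<le> 1 - s"
    if "norm y \<le> 1" "norm (c - t *\<^sub>R y) \<le> 1 - t" "s \<le> t" for c y :: 'a and s t :: real
  proof -
    have "norm (c - s *\<^sub>R y) \<le> norm (c - t *\<^sub>R y) + norm ((t - s) *\<^sub>R y)"
      using norm_triangle_ineq[of "c - t *\<^sub>R y" "(t - s) *\<^sub>R y"] by (simp add: algebra_simps)
    also have "norm ((t - s) *\<^sub>R y) \<le> t - s"
      using that mult_left_mono[of "norm y" 1 "t - s"] by simp
    finally show ?thesis using that by linarith
  qed
  have CF: "C \<subseteq> F"
  proof
    fix c assume "c \<in> C"
    then show "c \<in> F"
      using assms(3) unfolding F_def by (auto intro!: bexI[of _ c] exI[of _ 1])
  qed
  have conv: "convex F"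
    unfolding convex_def
  proof (intro ballI allI impI)
    fix x y and u v :: real
    assume xF: "x \<in> F" and yF: "y \<in> F" and uv: "0 \<le> u" "0 \<le> v" "u + v = 1"
    from xF obtain c s where c: "norm x \<le> 1" "c \<in> C" "0 < s" "s \<le> 1" "norm (c - s *\<^sub>R x) \<le> 1 - s"
      unfolding F_def by blast
    from yF obtain d t where d: "norm y \<le> 1" "d \<in> C" "0 < t" "t \<le> 1" "norm (d - t *\<^sub>R y) \<le> 1 - t"
      unfolding F_def by blast
    define r where "r = min s t"
    have r: "0 < r" "r \<le> 1" using c d by (auto simp: r_def)
    have cr: "norm (c - r *\<^sub>R x) \<le> 1 - r" using shrink[OF c(1) c(5), of r] by (simp add: r_def)
    have dr: "norm (d - r *\<^sub>R y) \<le> 1 - r" using shrink[OF d(1) d(5), of r] by (simp add: r_def)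
    have "norm (u *\<^sub>R x + v *\<^sub>R y) \<le> 1"
      using convexD[OF convex_cball, of x 0 1 y u v] c d uv by simp
    moreover have "u *\<^sub>R c + v *\<^sub>R d \<in> C"
      using assms(1) c d uv by (simp add: convexD)
    moreover have "norm ((u *\<^sub>R c + v *\<^sub>R d) - r *\<^sub>R (u *\<^sub>R x + v *\<^sub>R y)) \<le> 1 - r"
    proof -
      have "u *\<^sub>R (c - r *\<^sub>R x) + v *\<^sub>R (d - r *\<^sub>R y) \<in> cball 0 (1 - r)"
        using convexD[OF convex_cball, of "c - r *\<^sub>R x" 0 "1 - r" "d - r *\<^sub>R y" u v] cr dr uv by simp
      then show ?thesis by (simp add: algebra_simps)
    qed
    ultimately show "u *\<^sub>R x + v *\<^sub>R y \<in> F"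
      unfolding F_def using r by blast
  qed
  have sph: "F \<subseteq> sphere 0 1"
  proof
    fix y assume "y \<in> F"
    then obtain c t where c: "norm y \<le> 1" "c \<in> C" "0 < t" "norm (c - t *\<^sub>R y) \<le> 1 - t"
      unfolding F_def by blast
    have "norm c = 1" using c assms(3) by auto
    moreover have "norm c \<le> norm (c - t *\<^sub>R y) + norm (t *\<^sub>R y)"
      using norm_triangle_ineq[of "c - t *\<^sub>R y" "t *\<^sub>R y"] by simp
    moreover have "norm (t *\<^sub>R y) = t * norm y" using c(3) by simp
    ultimately have "t * 1 \<le> t * norm y" using c(4) by linarith
    then have "1 \<le> norm y" using c(3) by (rule mult_left_le_imp_le)
    then show "y \<in> sphere 0 1" using c(1) by simp
  qed
  have half: "y \<in> F" if yz: "norm y \<le> 1" "norm z \<le> 1" "(1 / 2) *\<^sub>R (y + z) \<in> F" for y z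
  proof -
    obtain c t where c: "c \<in> C" "0 < t" "t \<le> 1" "norm (c - t *\<^sub>R ((1 / 2) *\<^sub>R (y + z))) \<le> 1 - t"
      using yz(3) unfolding F_def by blast
    have "norm (c - (t / 2) *\<^sub>R y)
        \<le> norm (c - t *\<^sub>R ((1 / 2) *\<^sub>R (y + z))) + norm ((t / 2) *\<^sub>R z)"
      using norm_triangle_ineq[of "c - t *\<^sub>R ((1 / 2) *\<^sub>R (y + z))" "(t / 2) *\<^sub>R z"]
      by (simp add: algebra_simps)
    also have "norm ((t / 2) *\<^sub>R z) \<le> t / 2"
      using yz c mult_left_mono[of "norm z" 1 "t / 2"] by simp
    finally have "norm (c - (t / 2) *\<^sub>R y) \<le> 1 - t / 2" using c by linarith
    then show ?thesis
      unfolding F_def using yz c by (auto intro!: bexI[of _ c] exI[of _ "t / 2"])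
  qed
  have "unit_ball_face F"
    unfolding unit_ball_face_def
  proof (intro conjI ballI impI)
    show "F \<noteq> {}" using CF assms(2) by blast
  next
    fix y z :: 'a
    assume "y \<in> cball 0 1" "z \<in> cball 0 1" "(1 / 2) *\<^sub>R (y + z) \<in> F"
    then show "y \<in> F" "z \<in> F"
      using half[of y z] half[of z y] by (simp_all add: add.commute)
  qed (fact conv sph)+
  then show thesis using CF that by blast
qed

lemma norm_convex_comb_eq_1:
  fixes x y :: "'a::real_normed_vector"
  assumes "norm x = 1" "norm y = 1" "2 \<le> norm (x + y)" "0 \<le> u" "0 \<le> v" "u + v = 1"
  shows "norm (u *\<^sub>R y + v *\<^sub>R x) = 1"
proof (rule antisym)
  show "norm (u *\<^sub>R y + v *\<^sub>R x) \<le> 1"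
    using convexD[OF convex_cball, of y 0 1 x u v] assms by simp
  have wlog: "b + a \<le> norm (a *\<^sub>R p + b *\<^sub>R q)"
    if "norm p = 1" "2 \<le> norm (q + p)" "0 \<le> a" "a \<le> b" for p q :: 'a and a b :: real
  proof -
    have "b * 2 \<le> b * norm (q + p)" using that by (intro mult_left_mono) auto
    also have "\<dots> = norm ((a *\<^sub>R p + b *\<^sub>R q) + (b - a) *\<^sub>R p)"
      using that norm_scaleR[of b "q + p"] by (simp add: algebra_simps)
    also have "\<dots> \<le> norm (a *\<^sub>R p + b *\<^sub>R q) + (b - a)"
      using norm_triangle_ineq[of "a *\<^sub>R p + b *\<^sub>R q" "(b - a) *\<^sub>R p"] that by simp
    finally show ?thesis by simp
  qed
  show "1 \<le> norm (u *\<^sub>R y + v *\<^sub>R x)"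
    using wlog[of y x u v] wlog[of x y v u] assms
    by (cases "u \<le> v") (simp_all add: add.commute)
qed

lemma mem_maximal_unit_ball_face:
  fixes F :: "'a::real_normed_vector set"
  assumes F: "maximal_unit_ball_face F" and y: "norm y = 1"
    and far: "\<And>x. x \<in> F \<Longrightarrow> 2 \<le> norm (x + y)"
  shows "y \<in> F"
proof -
  have face: "F \<noteq> {}" "convex F" "F \<subseteq> sphere 0 1"
    using F by (auto simp: maximal_unit_ball_face_def unit_ball_face_def)
  have "convex hull (insert y F) \<subseteq> sphere 0 1"
  proof
    fix p assume "p \<in> convex hull (insert y F)"
    then obtain u v x where "0 \<le> u" "0 \<le> v" "u + v = 1" "x \<in> F" "p = u *\<^sub>R y + v *\<^sub>R x"
      using face by (auto simp: convex_hull_insert hull_same)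
    then show "p \<in> sphere 0 1"
      using norm_convex_comb_eq_1[of x y u v] y far[of x] face by auto
  qed
  then obtain F' where F': "unit_ball_face F'" "convex hull (insert y F) \<subseteq> F'"
    using convex_subset_sphere_in_face[of "convex hull (insert y F)"] by auto
  then have "insert y F \<subseteq> F'" using hull_subset[of "insert y F" convex] by blast
  then show ?thesis using F F'(1) by (auto simp: maximal_unit_ball_face_def)
qed

section \<open>A point of a maximal face far from being aligned with a compact set\<close>

text \<open>
  Averaging: a single point of \<open>F\<close> attains distance \<open>2\<close> from \<open>- y\<close> only where all the points of
  the finite set \<open>T\<close> do.
\<close>

lemma unit_ball_convex_average:
  fixes F :: "'a::real_normed_vector set"
  assumes "finite T" "T \<subseteq> F" "convex F" "F \<noteq> {}" "F \<subseteq> cball 0 1"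
  shows "\<exists>x\<in>F. \<forall>t\<in>T. \<forall>y. norm y \<le> 1 \<and> 2 \<le> norm (x + y) \<longrightarrow> 2 \<le> norm (t + y)"
  using assms(1,2)
proof (induction T rule: finite_induct)
  case empty
  then show ?case using assms(4) by blast
next
  case (insert a T)
  then obtain x where x: "x \<in> F"
    "\<And>t y. \<lbrakk>t \<in> T; norm y \<le> 1; 2 \<le> norm (x + y)\<rbrakk> \<Longrightarrow> 2 \<le> norm (t + y)"
    by blast
  have a: "a \<in> F" using insert by blast
  define z where "z = (1 / 2) *\<^sub>R x + (1 / 2) *\<^sub>R a"
  have "z \<in> F" using x(1) a assms(3) by (simp add: z_def convexD)
  moreover have "2 \<le> norm (x + y) \<and> 2 \<le> norm (a + y)" if "norm y \<le> 1" "2 \<le> norm (z + y)" for y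
  proof -
    have "z + y = (1 / 2) *\<^sub>R (x + y) + (1 / 2) *\<^sub>R (a + y)"
      unfolding z_def scaleR_add_right
      using scaleR_add_left[of "1/2" "1/2" y] by (simp add: algebra_simps)
    then have "norm (z + y) \<le> norm (x + y) / 2 + norm (a + y) / 2"
      using norm_triangle_ineq[of "(1 / 2) *\<^sub>R (x + y)" "(1 / 2) *\<^sub>R (a + y)"] by simp
    moreover have "norm (x + y) \<le> 2" "norm (a + y) \<le> 2"
      using norm_triangle_ineq[of x y] norm_triangle_ineq[of a y] x(1) a assms(5) that(1)
      by (auto simp: subset_iff)
    ultimately show ?thesis using that(2) by linarith
  qed
  ultimately show ?case using x(2) by (intro bexI[of _ z]) auto
qed

lemma maximal_unit_ball_face_uniform:
  fixes F S :: "'a::real_normed_vector set"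
  assumes F: "maximal_unit_ball_face F" and S: "compact S" "S \<subseteq> sphere 0 1" "S \<inter> F = {}"
  obtains x \<epsilon> where "x \<in> F" "0 \<le> \<epsilon>" "\<epsilon> < 1" "\<forall>y\<in>S. norm (x + y) \<le> 1 + \<epsilon>"
proof -
  have face: "F \<noteq> {}" "convex F" "F \<subseteq> sphere 0 1"
    using F by (auto simp: maximal_unit_ball_face_def unit_ball_face_def)
  have "\<exists>x\<in>F. norm (x + y) < 2" if "y \<in> S" for y
  proof (rule ccontr)
    assume "\<not> (\<exists>x\<in>F. norm (x + y) < 2)"
    then have "y \<in> F"
      using mem_maximal_unit_ball_face[OF F, of y] that S(2) by (auto simp: not_less)
    then show False using that S(3) by blast
  qed
  then have cover: "S \<subseteq> (\<Union>x\<in>F. {y. norm (x + y) < 2})" by blast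
  have "open {y. norm (x + y) < 2}" for x :: 'a
    by (intro open_Collect_less continuous_intros)
  then obtain T where T: "T \<subseteq> F" "finite T" "S \<subseteq> (\<Union>x\<in>T. {y. norm (x + y) < 2})"
    using compactE_image[OF S(1) _ cover] by metis
  obtain x where x: "x \<in> F"
    "\<And>t y. \<lbrakk>t \<in> T; norm y \<le> 1; 2 \<le> norm (x + y)\<rbrakk> \<Longrightarrow> 2 \<le> norm (t + y)"
    using unit_ball_convex_average[OF T(2,1) face(2,1)] face(3) by (force simp: subset_iff)
  have less: "norm (x + y) < 2" if "y \<in> S" for y
  proof (rule ccontr)
    assume "\<not> norm (x + y) < 2"
    moreover obtain t where "t \<in> T" "norm (t + y) < 2" using T(3) \<open>y \<in> S\<close> by blast
    moreover have "norm y \<le> 1" using that S(2) by auto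
    ultimately show False using x(2)[of t y] by simp
  qed
  show thesis
  proof (cases "S = {}")
    case True
    then show thesis using that[of x 0] x(1) by simp
  next
    case False
    have "continuous_on S (\<lambda>y. norm (x + y))" by (intro continuous_intros)
    then obtain m where m: "m \<in> S" "\<And>y. y \<in> S \<Longrightarrow> norm (x + y) \<le> norm (x + m)"
      using continuous_attains_sup[OF S(1) False] by blast
    \<comment> \<open>The maximum of \<open>\<parallel>x + y\<parallel>\<close> may be below \<open>1\<close>, so \<open>\<epsilon>\<close> is cut off at \<open>0\<close>.\<close>
    define \<epsilon> where "\<epsilon> = max 0 (norm (x + m) - 1)"
    have "\<epsilon> < 1" using less[OF m(1)] by (simp add: \<epsilon>_def)
    moreover have "norm (x + y) \<le> 1 + \<epsilon>" if "y \<in> S" for y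
      using m(2)[OF that] by (simp add: \<epsilon>_def)
    ultimately show thesis
      using that[of x \<epsilon>] x(1) by (simp add: \<epsilon>_def)
  qed
qed

section \<open>Compactness in finite-dimensional subspaces\<close>

context normed_space_over
begin

lemma continuous_on_scale_left: "continuous_on A (\<lambda>k. smul k b)"
proof -
  have "bounded_linear (\<lambda>k. smul k b)"
  proof (rule bounded_linear_intro[where K = "norm b"])
    fix r :: real and k :: 'k
    have "r *\<^sub>R k = of_real r * k" by (rule scaleR_conv_of_real)
    then show "smul (r *\<^sub>R k) b = r *\<^sub>R smul k b"
      by (metis scale_of_real scale_scale)
  qed (simp_all add: scale_left_distrib norm_scale)
  then show ?thesis by (rule linear_continuous_on)
qed

end

text \<open>
  Bounded closed subsets of a finite-dimensional subspace are compact. In the induction step, a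
  vector \<open>b\<close> outside the span \<open>V\<close> of the previous generators has a positive distance \<open>e\<close> from
  \<open>V\<close>; this bounds the coefficient of \<open>b\<close>, hence also the component in \<open>V\<close>, in terms of the norm.
\<close>

lemma compact_span_Int_cball:
  fixes smul :: "'k::{real_normed_field,heine_borel} \<Rightarrow> 'a::real_normed_vector \<Rightarrow> 'a"
  assumes "normed_space_over smul" "finite B"
  shows "compact (cball 0 R \<inter> module.span smul B)"
proof -
  interpret normed_space_over smul by (fact assms(1))
  show ?thesis
    using assms(2)
  proof (induction B arbitrary: R rule: finite_induct)
    case empty
    have "cball 0 R \<inter> span {} \<subseteq> {0}" by simp
    then show ?case by (meson finite.emptyI finite_imp_compact finite_insert finite_subset)
  next
    case (insert b B)
    show ?case
    proof (cases "b \<in> span B")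
      case True
      then show ?thesis using insert.IH by (simp add: span_redundant)
    next
      case False
      have "open (- (cball 0 (norm b + 1) \<inter> span B))"
        using compact_imp_closed[OF insert.IH] by (rule open_Compl)
      moreover have "b \<in> - (cball 0 (norm b + 1) \<inter> span B)" using False by blast
      ultimately obtain e0 where e0: "e0 > 0" "ball b e0 \<subseteq> - (cball 0 (norm b + 1) \<inter> span B)"
        by (meson openE)
      define e where "e = min e0 1"
      have e: "e > 0" using e0 by (simp add: e_def)
      have dist_b: "e \<le> norm (b - w)" if "w \<in> span B" for w
      proof (rule ccontr)
        assume "\<not> e \<le> norm (b - w)"
        then have lt: "norm (b - w) < e0" "norm (b - w) < 1" by (auto simp: e_def)
        have "norm w \<le> norm b + norm (b - w)" by (metis norm_triangle_sub norm_minus_commute)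
        then have "w \<in> ball b e0 \<inter> (cball 0 (norm b + 1) \<inter> span B)"
          using lt that by (auto simp: dist_norm)
        then show False using e0(2) by blast
      qed
      define g where "g = (\<lambda>p. smul (fst p) b + snd p)"
      define M where "M = R + R / e * norm b"
      define P where "P = cball (0::'k) (R / e) \<times> (cball 0 M \<inter> span B)"
      have "compact P" unfolding P_def by (intro compact_Times compact_cball insert.IH)
      moreover have "continuous_on P g"
        unfolding g_def
        by (intro continuous_intros continuous_on_compose2[OF continuous_on_scale_left[of UNIV]]) auto
      ultimately have "compact (g ` P)" by (simp add: compact_continuous_image)
      moreover have "cball 0 R \<inter> span (insert b B) = cball 0 R \<inter> g ` P"
      proof (intro equalityI subsetI)
        fix x assume "x \<in> cball 0 R \<inter> span (insert b B)"
        then obtain k where x: "norm x \<le> R" and w: "x - smul k b \<in> span B"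
          by (auto simp: span_breakdown_eq)
        have k: "norm k \<le> R / e"
        proof (cases "k = 0")
          case True
          then show ?thesis using x e order_trans[OF norm_ge_zero x] by simp
        next
          case False
          have "x = smul k (b - smul (- inverse k) (x - smul k b))"
            using False by (simp add: scale_right_diff_distrib)
          then have "norm x = norm k * norm (b - smul (- inverse k) (x - smul k b))"
            by (metis norm_scale)
          moreover have "e \<le> norm (b - smul (- inverse k) (x - smul k b))"
            by (intro dist_b span_scale w)
          ultimately have "norm k * e \<le> R"
            using x by (metis mult_left_mono norm_ge_zero order_trans)
          then show ?thesis using e by (simp add: field_simps)
        qed
        have "norm (x - smul k b) \<le> norm x + norm k * norm b"
          by (metis norm_scale norm_triangle_ineq4)
        also have "\<dots> \<le> M"
          unfolding M_def using x k by (intro add_mono mult_right_mono) auto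
        finally have "(k, x - smul k b) \<in> P" using k w by (simp add: P_def)
        then show "x \<in> cball 0 R \<inter> g ` P"
          using x by (auto simp: g_def intro!: image_eqI[of _ _ "(k, x - smul k b)"])
      next
        fix x assume "x \<in> cball 0 R \<inter> g ` P"
        then obtain k w where "norm x \<le> R" "w \<in> span B" "x = smul k b + w"
          by (auto simp: g_def P_def)
        moreover have "smul k b + w \<in> span (insert b B)"
        proof (rule span_add)
          show "smul k b \<in> span (insert b B)" by (simp add: span_scale span_base)
          show "w \<in> span (insert b B)"
            using \<open>w \<in> span B\<close> span_mono[of B "insert b B"] by blast
        qed
        ultimately show "x \<in> cball 0 R \<inter> span (insert b B)" by simp
      qed
      ultimately show ?thesis by (simp add: closed_Int_compact)
    qed
  qed
qed

section \<open>Strongly anti-coproximinal subspaces\<close>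

theorem strongly_anti_coproximinal_meets_maximal_face:
  fixes smul :: "'k::{real_normed_field,heine_borel} \<Rightarrow> 'a::real_normed_vector \<Rightarrow> 'a"
  assumes N: "normed_space_over smul" and Y: "finite_dim_subspace smul Y"
    and anti: "strongly_anti_coproximinal smul Y" and F: "maximal_unit_ball_face F"
  shows "Y \<inter> F \<noteq> {}"
proof
  assume disj: "Y \<inter> F = {}"
  interpret normed_space_over smul by (fact N)
  from Y obtain B where sub: "subspace Y" and B: "finite B" "span B = Y"
    by (auto simp: finite_dim_subspace_def)
  have "compact ({w. norm w = 1} \<inter> (cball 0 1 \<inter> Y))"
  proof (rule closed_Int_compact)
    show "closed {w::'a. norm w = 1}" by (intro closed_Collect_eq continuous_intros)
    show "compact (cball 0 1 \<inter> Y)"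
      using compact_span_Int_cball[OF N B(1), of 1] B(2) by simp
  qed
  moreover have "{w. norm w = 1} \<inter> (cball 0 1 \<inter> Y) \<subseteq> sphere 0 1" by auto
  moreover have "{w. norm w = 1} \<inter> (cball 0 1 \<inter> Y) \<inter> F = {}" using disj by blast
  ultimately obtain x \<epsilon> where x: "x \<in> F" and \<epsilon>: "0 \<le> \<epsilon>" "\<epsilon> < 1"
    and near': "\<forall>w \<in> {w. norm w = 1} \<inter> (cball 0 1 \<inter> Y). norm (x + w) \<le> 1 + \<epsilon>"
    by (rule maximal_unit_ball_face_uniform[OF F])
  have near: "norm (x + w) \<le> 1 + \<epsilon>" if "w \<in> Y" "norm w = 1" for w
    using near' that by simp
  have x1: "norm x = 1"
  proof -
    have "F \<subseteq> sphere 0 1"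
      using F by (simp add: maximal_unit_ball_face_def unit_ball_face_def)
    then show ?thesis using x by auto
  qed
  have "norm y - \<epsilon> * norm (smul c x) \<le> norm (y + smul c x)" if y: "y \<in> Y" for y c
  proof (cases "y = 0 \<or> c = 0")
    case True
    then show ?thesis using \<epsilon>(1) by (auto simp: norm_scale intro: order_trans[of _ 0])
  next
    case False
    define s where "s = norm y / norm c"
    have s: "s > 0" using False by (simp add: s_def)
    \<comment> \<open>The unit vector \<open>w\<close> is chosen so that \<open>y + c x = - c (s w - x)\<close>.\<close>
    define w where "w = smul (- inverse (of_real s * c)) y"
    have w: "w \<in> Y" unfolding w_def using sub y by (rule subspace_scale)
    have w1: "norm w = 1"
      using False s by (simp add: w_def norm_scale norm_mult norm_inverse) (simp add: s_def)
    have "s *\<^sub>R w = smul (- inverse c) y"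
      using s by (simp add: w_def flip: scale_of_real)
    then have "y + smul c x = smul (- c) (s *\<^sub>R w - x)"
      using False by (simp add: scale_right_diff_distrib)
    then have eq: "norm (y + smul c x) = norm c * norm (s *\<^sub>R w - x)"
      by (simp add: norm_scale)
    have "(s + 1) *\<^sub>R w = (s *\<^sub>R w - x) + (x + w)" by (simp add: algebra_simps)
    then have "norm ((s + 1) *\<^sub>R w) \<le> norm (s *\<^sub>R w - x) + norm (x + w)"
      by (metis norm_triangle_ineq)
    moreover have "norm ((s + 1) *\<^sub>R w) = s + 1" using s w1 by simp
    ultimately have "s - \<epsilon> \<le> norm (s *\<^sub>R w - x)" using near[OF w w1] by linarith
    then have "norm c * (s - \<epsilon>) \<le> norm (y + smul c x)"
      unfolding eq by (intro mult_left_mono) auto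
    then show ?thesis
      using False x1 by (simp add: norm_scale s_def field_simps)
  qed
  then have "eps_best_coapproximation smul \<epsilon> Y x 0"
    using subspace_0[OF sub]
    by (simp add: eps_best_coapproximation_def eps_birkhoff_orthogonal_def)
  moreover have "x \<notin> Y" using x disj by blast
  ultimately show False
    using anti \<epsilon> by (auto simp: strongly_anti_coproximinal_def)
qed

theorem theorem3p8:
  fixes Y :: "'a::banach set"
    and scaleC :: "complex \<Rightarrow> 'b::banach \<Rightarrow> 'b" and Z :: "'b set"
  shows "(finite_dim_subspace (scaleR :: real \<Rightarrow> 'a \<Rightarrow> 'a) Y \<and>
          strongly_anti_coproximinal (scaleR :: real \<Rightarrow> 'a \<Rightarrow> 'a) Y \<longrightarrow>
            (\<forall>F. maximal_unit_ball_face F \<longrightarrow> Y \<inter> F \<noteq> {})) \<and>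
         (normed_space_over scaleC \<and> finite_dim_subspace scaleC Z \<and>
          strongly_anti_coproximinal scaleC Z \<longrightarrow>
            (\<forall>F. maximal_unit_ball_face F \<longrightarrow> Z \<inter> F \<noteq> {}))"
  using strongly_anti_coproximinal_meets_maximal_face[OF normed_space_over_scaleR, of Y]
    strongly_anti_coproximinal_meets_maximal_face[of scaleC Z]
  by blast

end
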